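(* Let $\mathcal{H}$ be a complex Hilbert space and let $A,B\in\mathcal{B}(\mathcal{H})$. Then $$dw^2\begin{pmatrix} 0 & A\\ B & 0\end{pmatrix}\leq\frac{1}{2}\max\left\{\left\||B|^2+|A^*|^2+2|B|^4\right\|,\ \left\||A|^2+|B^*|^2+2|A|^4\right\|\right\}.$$
   Context: $\mathcal{B}(\mathcal{H})$ is the algebra of bounded linear operators on the complex Hilbert space $\mathcal{H}$, with operator norm $\|\cdot\|$, and $|S|=(S^*S)^{1/2}$ for $S\in\mathcal{B}(\mathcal{H})$. A $2\times2$ operator matrix acts on the Hilbert space direct sum $\mathcal{H}\oplus\mathcal{H}$ (norm $\|(x,y)\|^2=\|x\|^2+\|y\|^2$) in the usual way. For a bounded operator $T$ on a complex Hilbert space, the Davis-Wielandt radius is $dw(T)=\sup\{\sqrt{|\langle Tz,z\rangle|^2+\|Tz\|^4}: \|z\|=1\}$, and $dw^2(T)=(dw(T))^2$. *)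

theory Defs
  imports "HOL-Analysis.Analysis"
begin

class complex_vector = real_vector +
  fixes scaleC :: "complex \<Rightarrow> 'a \<Rightarrow> 'a" (infixr "*\<^sub>C" 75)
  assumes scaleC_add_right: "a *\<^sub>C (x + y) = a *\<^sub>C x + a *\<^sub>C y"
    and scaleC_add_left: "(a + b) *\<^sub>C x = a *\<^sub>C x + b *\<^sub>C x"
    and scaleC_scaleC: "a *\<^sub>C (b *\<^sub>C x) = (a * b) *\<^sub>C x"
    and scaleC_of_real: "complex_of_real r *\<^sub>C x = r *\<^sub>R x"

text \<open>The inner product is linear in its first argument. Its values determine the given norm, so
  the metric, the topology and the operator norm \<^const>\<open>onorm\<close> are those of the library.\<close>

class complex_inner = complex_vector + real_normed_vector +
  fixes cinner :: "'a \<Rightarrow> 'a \<Rightarrow> complex"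
  assumes cinner_commute: "cinner x y = cnj (cinner y x)"
    and cinner_add_left: "cinner (x + y) z = cinner x z + cinner y z"
    and cinner_scaleC_left: "cinner (c *\<^sub>C x) y = c * cinner x y"
    and cinner_self: "cinner x x = complex_of_real ((norm x)\<^sup>2)"

class chilbert_space = complex_inner + banach

text \<open>The Hilbert space direct sum: the norm on pairs is already the Euclidean combination
  of the component norms.\<close>

instantiation prod :: (complex_vector, complex_vector) complex_vector
begin

definition scaleC_prod_def: "c *\<^sub>C p = (c *\<^sub>C fst p, c *\<^sub>C snd p)"

instance
  by standard
    (simp_all add: scaleC_prod_def scaleC_add_right scaleC_add_left scaleC_scaleC scaleC_of_real
      scaleR_prod_def)

end

instantiation prod :: (complex_inner, complex_inner) complex_inner
begin

definition cinner_prod_def: "cinner p q = cinner (fst p) (fst q) + cinner (snd p) (snd q)"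

instance
proof
  fix p q r :: "'a \<times> 'b" and c :: complex
  show "cinner p q = cnj (cinner q p)"
    by (simp add: cinner_prod_def cinner_commute[of "fst p"] cinner_commute[of "snd p"])
  show "cinner (p + q) r = cinner p r + cinner q r"
    by (simp add: cinner_prod_def cinner_add_left)
  show "cinner (c *\<^sub>C p) q = c * cinner p q"
    by (simp add: cinner_prod_def scaleC_prod_def cinner_scaleC_left distrib_left)
  show "cinner p p = complex_of_real ((norm p)\<^sup>2)"
    by (simp add: cinner_prod_def cinner_self norm_prod_def)
qed

end

instance prod :: (chilbert_space, chilbert_space) chilbert_space ..

definition bounded_clinear :: "('a::complex_inner \<Rightarrow> 'b::complex_inner) \<Rightarrow> bool" where
  "bounded_clinear T \<longleftrightarrow> bounded_linear T \<and> (\<forall>c x. T (c *\<^sub>C x) = c *\<^sub>C T x)"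

definition adjoint_op :: "('a::chilbert_space \<Rightarrow> 'a) \<Rightarrow> 'a \<Rightarrow> 'a" where
  "adjoint_op T = (THE S. bounded_clinear S \<and> (\<forall>x y. cinner (T x) y = cinner x (S y)))"

definition positive_op :: "('a::chilbert_space \<Rightarrow> 'a) \<Rightarrow> bool" where
  "positive_op P \<longleftrightarrow> bounded_clinear P \<and> (\<forall>x. cinner (P x) x \<in> \<real>\<^sub>\<ge>\<^sub>0)"

text \<open>A positive operator has exactly one positive square root, so the choice is immaterial.\<close>

definition sqrt_op :: "('a::chilbert_space \<Rightarrow> 'a) \<Rightarrow> 'a \<Rightarrow> 'a" where
  "sqrt_op T = (SOME P. positive_op P \<and> P \<circ> P = T)"

definition abs_op :: "('a::chilbert_space \<Rightarrow> 'a) \<Rightarrow> 'a \<Rightarrow> 'a" where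
  "abs_op T = sqrt_op (adjoint_op T \<circ> T)"

definition op_matrix ::
  "('a::complex_inner \<Rightarrow> 'a) \<Rightarrow> ('a \<Rightarrow> 'a) \<Rightarrow> ('a \<Rightarrow> 'a) \<Rightarrow> ('a \<Rightarrow> 'a) \<Rightarrow> 'a \<times> 'a \<Rightarrow> 'a \<times> 'a" where
  "op_matrix P Q R S = (\<lambda>(x, y). (P x + Q y, R x + S y))"

text \<open>The Davis-Wielandt radius. All values are nonnegative; inserting \<open>0\<close> only matters on the zero
  space, which has no unit vectors and where the supremum is then \<open>0\<close>
  (\<open>Sup {}\<close> is unspecified for reals).\<close>

definition dw_radius :: "('a::chilbert_space \<Rightarrow> 'a) \<Rightarrow> real" where
  "dw_radius T =
    Sup (insert 0 {sqrt ((cmod (cinner (T z) z))\<^sup>2 + norm (T z) ^ 4) | z. norm z = 1})"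

end

theory Submission
  imports Defs
begin

text \<open>Write \<open>T = (0, A; B, 0)\<close>, so that \<open>T\<^sup>*T = diag(B\<^sup>*B, A\<^sup>*A)\<close> and
  \<open>TT\<^sup>* = diag(AA\<^sup>*, BB\<^sup>*)\<close>. For a unit vector \<open>z\<close> the Cauchy-Schwarz inequality bounds
  \<open>|\<langle>Tz, z\<rangle>|\<close> both by \<open>\<parallel>Tz\<parallel>\<close> and by \<open>\<parallel>T\<^sup>*z\<parallel>\<close>, hence its square by the mean of the squares,
  and it bounds \<open>\<parallel>Tz\<parallel>\<^sup>2 = \<langle>T\<^sup>*Tz, z\<rangle>\<close> by \<open>\<parallel>T\<^sup>*Tz\<parallel>\<close>. The sum of the two bounds is half the
  quadratic form of a block diagonal operator whose diagonal blocks are the two operators of the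
  theorem.

  Adjoints are obtained by minimising \<open>\<parallel>x\<parallel>\<^sup>2 / 2 - Re (f x)\<close>. The square root of \<open>I - S\<close> for a
  self-adjoint contraction \<open>S\<close> is \<open>I - Y\<close>, where \<open>Y\<close> is the limit of the iteration
  \<open>Y \<mapsto> (S + Y\<^sup>2) / 2\<close>, which is dominated in norm by its scalar analogue.\<close>

section \<open>Complex inner products\<close>

lemma cinner_add_right: "cinner x (y + z) = cinner x y + cinner x z"
  for x y z :: "'a::complex_inner"
  by (metis cinner_add_left cinner_commute complex_cnj_add)

lemma cinner_scaleC_right: "cinner x (c *\<^sub>C y) = cnj c * cinner x y"
  for x y :: "'a::complex_inner"
  by (metis cinner_scaleC_left cinner_commute complex_cnj_mult)

lemma cinner_scaleR_left: "cinner (r *\<^sub>R x) y = of_real r * cinner x y"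
  for x y :: "'a::complex_inner"
  by (metis cinner_scaleC_left scaleC_of_real)

lemma cinner_scaleR_right: "cinner x (r *\<^sub>R y) = of_real r * cinner x y"
  for x y :: "'a::complex_inner"
  by (metis cinner_scaleC_right scaleC_of_real complex_cnj_complex_of_real)

lemma cinner_diff_left: "cinner (x - y) z = cinner x z - cinner y z"
  for x y z :: "'a::complex_inner"
  by (metis add_diff_cancel_right' cinner_add_left diff_add_cancel)

lemma cinner_diff_right: "cinner x (y - z) = cinner x y - cinner x z"
  for x y z :: "'a::complex_inner"
  by (metis add_diff_cancel_right' cinner_add_right diff_add_cancel)

lemma scaleC_diff_right: "c *\<^sub>C (x - y) = c *\<^sub>C x - c *\<^sub>C y"
  for x y :: "'a::complex_vector"
  by (metis add_diff_cancel_right' scaleC_add_right diff_add_cancel)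

lemma scaleC_scaleR: "c *\<^sub>C (r *\<^sub>R x) = r *\<^sub>R (c *\<^sub>C x)"
  for x :: "'a::complex_vector"
  by (metis mult.commute scaleC_of_real scaleC_scaleC)

text \<open>The norm axioms cover real scalars only; complex homogeneity has to come from the inner
  product through \<open>cinner_self\<close>.\<close>

lemma norm_scaleC: "norm (c *\<^sub>C x) = cmod c * norm x"
  for x :: "'a::complex_inner"
proof -
  have "complex_of_real ((norm (c *\<^sub>C x))\<^sup>2) = (c * cnj c) * complex_of_real ((norm x)\<^sup>2)"
    by (simp only: cinner_self[symmetric] cinner_scaleC_left cinner_scaleC_right mult_ac)
  also have "\<dots> = complex_of_real ((cmod c * norm x)\<^sup>2)"
    by (simp add: complex_norm_square[symmetric] power_mult_distrib)
  finally have "(norm (c *\<^sub>C x))\<^sup>2 = (cmod c * norm x)\<^sup>2"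
    using of_real_eq_iff by blast
  then show ?thesis by simp
qed

lemma Re_cinner_commute: "Re (cinner x y) = Re (cinner y x)"
  for x y :: "'a::complex_inner"
  by (subst cinner_commute) simp

lemma norm_add_square: "(norm (x + y))\<^sup>2 = (norm x)\<^sup>2 + 2 * Re (cinner x y) + (norm y)\<^sup>2"
  for x y :: "'a::complex_inner"
proof -
  have "(norm z)\<^sup>2 = Re (cinner z z)" for z :: 'a by (simp add: cinner_self)
  then show ?thesis
    by (simp add: cinner_add_left cinner_add_right Re_cinner_commute[of y x])
qed

lemma norm_diff_square: "(norm (x - y))\<^sup>2 = (norm x)\<^sup>2 - 2 * Re (cinner x y) + (norm y)\<^sup>2"
  for x y :: "'a::complex_inner"
proof -
  have "(norm z)\<^sup>2 = Re (cinner z z)" for z :: 'a by (simp add: cinner_self)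
  then show ?thesis
    by (simp add: cinner_diff_left cinner_diff_right Re_cinner_commute[of y x])
qed

lemma cinner_ext:
  fixes x y :: "'a::complex_inner"
  assumes "\<And>z. cinner z x = cinner z y"
  shows "x = y"
proof -
  have "cinner (x - y) (x - y) = 0"
    using assms[of "x - y"] by (simp add: cinner_diff_right)
  then show ?thesis by (simp add: cinner_self)
qed

text \<open>As \<open>norm\<close> is already known to be a norm, Cauchy-Schwarz can be read off
  from the squared triangle inequality.\<close>

lemma Re_cinner_le: "Re (cinner x y) \<le> norm x * norm y"
  for x y :: "'a::complex_inner"
proof -
  have "(norm (x + y))\<^sup>2 \<le> (norm x + norm y)\<^sup>2"
    by (simp add: norm_triangle_ineq power_mono)
  then show ?thesis by (simp add: norm_add_square power2_sum)
qed

lemma cmod_cinner_le: "cmod (cinner x y) \<le> norm x * norm y"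
  for x y :: "'a::complex_inner"
proof (cases "cinner x y = 0")
  case False
  \<comment> \<open>A phase of modulus 1 that rotates \<open>cinner x y\<close> onto the positive
    real axis, where the bound on real parts suffices.\<close>
  define c where "c = cnj (cinner x y) / of_real (cmod (cinner x y))"
  have "cmod c = 1" using False by (simp add: c_def norm_divide)
  moreover have "cinner (c *\<^sub>C x) y = of_real (cmod (cinner x y))"
    using False complex_norm_square[of "cinner x y"]
    by (simp add: cinner_scaleC_left c_def field_simps power2_eq_square)
  ultimately show ?thesis
    using Re_cinner_le[of "c *\<^sub>C x" y] by (simp add: norm_scaleC)
qed auto

lemma bounded_bilinear_cinner:
  "bounded_bilinear (cinner :: 'a::complex_inner \<Rightarrow> 'a \<Rightarrow> complex)"
proof
  show "\<exists>K. \<forall>a b::'a. norm (cinner a b) \<le> norm a * norm b * K"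
    using cmod_cinner_le by (intro exI[of _ 1]) auto
qed (simp_all add: cinner_add_left cinner_add_right cinner_scaleR_left cinner_scaleR_right
      scaleR_conv_of_real)

lemma bounded_clinear_scaleC: "bounded_clinear (\<lambda>x::'a::complex_inner. c *\<^sub>C x)"
  unfolding bounded_clinear_def
  by (auto simp: scaleC_add_right scaleC_scaleR norm_scaleC scaleC_scaleC mult.commute
      intro!: bounded_linear_intro[where K = "cmod c"])

lemma bounded_clinear_comp:
  assumes "bounded_clinear S" and "bounded_clinear T"
  shows "bounded_clinear (\<lambda>x. S (T x))"
  using assms unfolding bounded_clinear_def by (auto intro: bounded_linear_compose)

section \<open>Adjoints\<close>

text \<open>First-order condition for a quadratic polynomial in \<open>t\<close> with its minimum at
  0.\<close>

lemma linear_coeff_eq_0: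
  fixes d c :: real
  assumes "\<And>t. 0 \<le> t * d + t\<^sup>2 * c" and "0 \<le> c"
  shows "d = 0"
proof -
  \<comment> \<open>The test value is \<open>t = - d / (c + 1)\<close>; the \<open>+ 1\<close> keeps
    the denominator positive when \<open>c = 0\<close>.\<close>
  have "- (d\<^sup>2 / (c + 1)\<^sup>2) = (- d / (c + 1)) * d + (- d / (c + 1))\<^sup>2 * c"
    using \<open>0 \<le> c\<close> by (simp add: divide_simps power2_eq_square) (simp add: algebra_simps)
  then have "d\<^sup>2 / (c + 1)\<^sup>2 \<le> 0" using assms(1)[of "- d / (c + 1)"] by simp
  then show ?thesis using \<open>0 \<le> c\<close> by (simp add: divide_le_0_iff)
qed

text \<open>By the parallelogram law every minimising sequence of \<open>J\<close> is Cauchy; at its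
  limit the derivative of \<open>J\<close> vanishes in each direction \<open>h\<close>, which is the
  claimed identity.\<close>

lemma riesz_representation_Re:
  fixes g :: "'a::chilbert_space \<Rightarrow> real"
  assumes "bounded_linear g"
  obtains u where "\<And>h. g h = Re (cinner h u)"
proof -
  interpret g: bounded_linear g by fact
  define J where "J x = (norm x)\<^sup>2 / 2 - g x" for x
  obtain K where K: "\<And>x. norm (g x) \<le> norm x * K" using g.bounded by blast
  \<comment> \<open>Completing the square in \<open>norm x\<close>.\<close>
  have low: "- (K\<^sup>2 / 2) \<le> J x" for x
  proof -
    have "g x \<le> norm x * K" using K[of x] by simp
    moreover have "0 \<le> (norm x - K)\<^sup>2" by simp
    ultimately show ?thesis by (simp add: J_def power2_diff)
  qed
  then have bdd: "bdd_below (range J)" by (intro bdd_belowI) auto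
  define m where "m = (INF x. J x)"
  have m_le: "m \<le> J x" for x unfolding m_def using bdd by (intro cINF_lower) auto
  have "\<exists>x. J x < m + 1 / real (Suc n)" for n
    using bdd cINF_less_iff[of UNIV J "m + 1 / real (Suc n)"] by (auto simp: m_def)
  then obtain X where X: "\<And>n. J (X n) < m + 1 / real (Suc n)" by metis
  \<comment> \<open>\<open>J a + J b\<close> exceeds twice the value of \<open>J\<close> at the
    midpoint by exactly \<open>(norm (a - b))\<^sup>2 / 4\<close>, and that value is at least
    \<open>m\<close>.\<close>
  have par: "(norm (a - b))\<^sup>2 \<le> 4 * (J a + J b - 2 * m)" for a b
  proof -
    have "(norm ((1/2) *\<^sub>R (a + b)))\<^sup>2 = (norm (a + b))\<^sup>2 / 4"
      by (simp add: power_divide)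
    then have "J ((1/2) *\<^sub>R (a + b)) = (norm (a + b))\<^sup>2 / 8 - (g a + g b) / 2"
      unfolding J_def g.scaleR g.add by simp
    with m_le[of "(1/2) *\<^sub>R (a + b)"] show ?thesis
      unfolding J_def norm_diff_square[of a b] norm_add_square[of a b] by argo
  qed
  have "Cauchy X"
  proof (rule metric_CauchyI)
    fix e :: real assume "0 < e"
    \<comment> \<open>Two values of \<open>J\<close> within \<open>e\<^sup>2 / 8\<close> of
      \<open>m\<close> make the right-hand side of \<open>par\<close> smaller than
      \<open>e\<^sup>2\<close>.\<close>
    then obtain N where N: "8 / e\<^sup>2 < real N" using reals_Archimedean2 by blast
    have "dist (X i) (X j) < e" if "i \<ge> N" "j \<ge> N" for i j
    proof -
      have 1: "J (X k) < m + e\<^sup>2 / 8" if "k \<ge> N" for k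
      proof -
        have "8 / e\<^sup>2 < real (Suc k)" using N that by linarith
        then have "1 / real (Suc k) < e\<^sup>2 / 8" using \<open>0 < e\<close> by (simp add: field_simps)
        then show ?thesis using X[of k] by linarith
      qed
      have "(norm (X i - X j))\<^sup>2 < e\<^sup>2"
        using par[of "X i" "X j"] 1[OF that(1)] 1[OF that(2)] by argo
      then show ?thesis using \<open>0 < e\<close> by (simp add: dist_norm power_less_imp_less_base)
    qed
    then show "\<exists>N. \<forall>i\<ge>N. \<forall>j\<ge>N. dist (X i) (X j) < e" by blast
  qed
  then obtain u where u: "X \<longlonglongrightarrow> u" using Cauchy_convergent_iff convergent_def by blast
  have "(\<lambda>n. J (X n)) \<longlonglongrightarrow> J u"
    unfolding J_def using u by (intro tendsto_intros g.tendsto) auto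
  moreover have "(\<lambda>n. m + 1 / real (Suc n)) \<longlonglongrightarrow> m"
    using LIMSEQ_inverse_real_of_nat_add[of m] by (simp add: inverse_eq_divide)
  ultimately have "J u \<le> m"
    by (rule LIMSEQ_le) (use X in \<open>auto intro: less_imp_le\<close>)
  have "g h = Re (cinner h u)" for h
  proof -
    \<comment> \<open>This polynomial in \<open>t\<close> is
      \<open>J (u + t *\<^sub>R h) - J u\<close>; its linear coefficient is the directional
      derivative.\<close>
    have "0 \<le> t * (Re (cinner h u) - g h) + t\<^sup>2 * ((norm h)\<^sup>2 / 2)" for t
    proof -
      have "J u \<le> J (u + t *\<^sub>R h)" using \<open>J u \<le> m\<close> m_le order_trans by blast
      moreover have "J (u + t *\<^sub>R h) = J u + (t * (Re (cinner h u) - g h) + t\<^sup>2 * ((norm h)\<^sup>2 / 2))"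
        by (simp add: J_def norm_add_square g.add g.scaleR cinner_scaleR_right power_mult_distrib
            Re_cinner_commute[of u h] algebra_simps add_divide_distrib)
      ultimately show ?thesis by linarith
    qed
    from linear_coeff_eq_0[OF this] show ?thesis by simp
  qed
  then show ?thesis using that by blast
qed

lemma riesz_representation:
  fixes f :: "'a::chilbert_space \<Rightarrow> complex"
  assumes "bounded_linear f" and f: "\<And>c x. f (c *\<^sub>C x) = c * f x"
  obtains u where "\<And>h. f h = cinner h u"
proof -
  have "bounded_linear (\<lambda>h. Re (f h))"
    using assms(1) bounded_linear_Re bounded_linear_compose by blast
  then obtain u where u: "\<And>h. Re (f h) = Re (cinner h u)"
    using riesz_representation_Re by blast
  \<comment> \<open>Complex linearity in \<open>h\<close> turns the real part at
    \<open>\<i> *\<^sub>C h\<close> into minus the imaginary part at \<open>h\<close>, on both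
    sides.\<close>
  have "Im (f h) = Im (cinner h u)" for h
    using u[of "\<i> *\<^sub>C h"] by (simp add: f cinner_scaleC_left)
  with u have "f h = cinner h u" for h by (simp add: complex_eq_iff)
  then show ?thesis using that by blast
qed

text \<open>Riesz gives \<open>S y\<close> for each \<open>y\<close> separately. Linearity follows
  by testing against all vectors, and the bound \<open>K\<close> of \<open>T\<close> carries over by
  cancelling one factor \<open>norm (S y)\<close>.\<close>

lemma adjoint_exists:
  fixes T :: "'a::chilbert_space \<Rightarrow> 'a"
  assumes T: "bounded_clinear T"
  shows "\<exists>S. bounded_clinear S \<and> (\<forall>x y. cinner (T x) y = cinner x (S y))"
proof -
  interpret T: bounded_linear T using T by (simp add: bounded_clinear_def)
  have Tc: "T (c *\<^sub>C x) = c *\<^sub>C T x" for c x using T by (simp add: bounded_clinear_def)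
  have "\<exists>u. \<forall>x. cinner (T x) y = cinner x u" for y
  proof -
    have "bounded_linear (\<lambda>x. cinner (T x) y)"
      using bounded_linear_compose[OF bounded_bilinear.bounded_linear_left[OF bounded_bilinear_cinner]
          T.bounded_linear] .
    then obtain u where "\<And>x. cinner (T x) y = cinner x u"
      using riesz_representation[of "\<lambda>x. cinner (T x) y"] by (auto simp: Tc cinner_scaleC_left)
    then show ?thesis by blast
  qed
  then obtain S where S: "\<And>x y. cinner (T x) y = cinner x (S y)" by metis
  obtain K where K: "0 < K" "\<And>x. norm (T x) \<le> norm x * K" using T.pos_bounded by blast
  have "norm (S y) \<le> norm y * K" for y
  proof -
    have "(norm (S y))\<^sup>2 = Re (cinner (T (S y)) y)" by (simp add: S cinner_self)
    also have "\<dots> \<le> norm (T (S y)) * norm y" by (rule Re_cinner_le)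
    also have "\<dots> \<le> norm (S y) * K * norm y" using K(2) by (simp add: mult_right_mono)
    finally have "norm (S y) * norm (S y) \<le> norm (S y) * (norm y * K)"
      by (simp add: power2_eq_square mult_ac)
    then show ?thesis using K(1) by (cases "S y = 0") auto
  qed
  moreover have "S (x + y) = S x + S y" for x y
    by (rule cinner_ext) (simp add: S[symmetric] cinner_add_right)
  moreover have "S (r *\<^sub>R x) = r *\<^sub>R S x" for r x
    by (rule cinner_ext) (simp add: S[symmetric] cinner_scaleR_right)
  moreover have "S (c *\<^sub>C x) = c *\<^sub>C S x" for c x
    by (rule cinner_ext) (simp add: S[symmetric] cinner_scaleC_right)
  ultimately have "bounded_clinear S"
    unfolding bounded_clinear_def by (blast intro: bounded_linear_intro)
  with S show ?thesis by blast
qed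

text \<open>Existence and uniqueness together let the definite description in
  \<open>adjoint_op\<close> be unfolded.\<close>

lemma
  fixes T :: "'a::chilbert_space \<Rightarrow> 'a"
  assumes "bounded_clinear T"
  shows bounded_clinear_adjoint_op: "bounded_clinear (adjoint_op T)"
    and cinner_adjoint_op: "cinner (T x) y = cinner x (adjoint_op T y)"
proof -
  have "\<exists>!S. bounded_clinear S \<and> (\<forall>x y. cinner (T x) y = cinner x (S y))"
  proof (rule ex_ex1I[OF adjoint_exists[OF assms]])
    fix S S'
    assume "bounded_clinear S \<and> (\<forall>x y. cinner (T x) y = cinner x (S y))"
      and "bounded_clinear S' \<and> (\<forall>x y. cinner (T x) y = cinner x (S' y))"
    then show "S = S'" by (intro ext cinner_ext) metis
  qed
  from theI'[OF this, folded adjoint_op_def]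
  have *: "bounded_clinear (adjoint_op T) \<and> (\<forall>x y. cinner (T x) y = cinner x (adjoint_op T y))" .
  from * show "bounded_clinear (adjoint_op T)" by (rule conjunct1)
  from * show "cinner (T x) y = cinner x (adjoint_op T y)" by blast
qed

lemma cinner_adjoint_op': "cinner (adjoint_op T x) y = cinner x (T y)"
  if "bounded_clinear T" for T :: "'a::chilbert_space \<Rightarrow> 'a"
  by (metis cinner_adjoint_op[OF that] cinner_commute)

section \<open>Square roots\<close>

text \<open>A fixed point satisfies \<open>2 Y = S + Y\<^sup>2\<close>, that is, the square of
  \<open>I - Y\<close> is \<open>I - S\<close>.\<close>

primrec sqrt_iter :: "('a::real_normed_vector \<Rightarrow>\<^sub>L 'a) \<Rightarrow> nat \<Rightarrow> 'a \<Rightarrow>\<^sub>L 'a" where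
  "sqrt_iter S 0 = 0"
| "sqrt_iter S (Suc n) = (1/2) *\<^sub>R (S + (sqrt_iter S n o\<^sub>L sqrt_iter S n))"

text \<open>The same iteration with \<open>S\<close> replaced by the scalar 1, the largest norm
  allowed for \<open>S\<close>.\<close>

primrec sqrt_iter_bound :: "nat \<Rightarrow> real" where
  "sqrt_iter_bound 0 = 0"
| "sqrt_iter_bound (Suc n) = (1 + (sqrt_iter_bound n)\<^sup>2) / 2"

lemma sqrt_iter_bound_range: "0 \<le> sqrt_iter_bound n \<and> sqrt_iter_bound n \<le> 1"
  by (induction n) (auto simp: power_le_one)

lemma incseq_sqrt_iter_bound: "incseq sqrt_iter_bound"
proof (rule incseq_SucI)
  fix n
  have "0 \<le> (1 - sqrt_iter_bound n)\<^sup>2" by simp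
  then show "sqrt_iter_bound n \<le> sqrt_iter_bound (Suc n)" by (simp add: power2_diff)
qed

lemma norm_sqrt_iter_le:
  assumes "norm S \<le> 1"
  shows "norm (sqrt_iter S n) \<le> sqrt_iter_bound n"
proof (induction n)
  case (Suc n)
  let ?Y = "sqrt_iter S n"
  have "norm (?Y o\<^sub>L ?Y) \<le> (sqrt_iter_bound n)\<^sup>2"
    using norm_blinfun_compose[of ?Y ?Y] mult_mono[OF Suc Suc] sqrt_iter_bound_range[of n]
    by (simp add: power2_eq_square)
  then have "norm (S + (?Y o\<^sub>L ?Y)) \<le> 1 + (sqrt_iter_bound n)\<^sup>2"
    using assms norm_triangle_ineq[of S "?Y o\<^sub>L ?Y"] by linarith
  then show ?case by simp
qed simp

text \<open>Increments, and not just iterates, are dominated by the scalar ones; this is what yields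
  convergence.\<close>

lemma norm_sqrt_iter_Suc_diff_le:
  assumes "norm S \<le> 1"
  shows "norm (sqrt_iter S (Suc n) - sqrt_iter S n) \<le> sqrt_iter_bound (Suc n) - sqrt_iter_bound n"
proof (induction n)
  case 0
  then show ?case using assms norm_sqrt_iter_le[OF assms, of 1] by simp
next
  case (Suc n)
  let ?X = "sqrt_iter S n" and ?Y = "sqrt_iter S (Suc n)"
  let ?x = "sqrt_iter_bound n" and ?y = "sqrt_iter_bound (Suc n)"
  have xy: "0 \<le> ?x" "0 \<le> ?y" using sqrt_iter_bound_range by blast+
  have "?x \<le> ?y" using incseq_sqrt_iter_bound by (simp only: incseq_SucD)
  have "sqrt_iter S (Suc (Suc n)) - ?Y = (1/2) *\<^sub>R ((?Y o\<^sub>L ?Y) - (?X o\<^sub>L ?X))"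
    by (simp add: algebra_simps del: sqrt_iter.simps)
      (simp add: algebra_simps)
  \<comment> \<open>This splitting of a difference of squares is valid without commutativity, and
    each factor has a scalar bound.\<close>
  also have "(?Y o\<^sub>L ?Y) - (?X o\<^sub>L ?X) = (?Y o\<^sub>L (?Y - ?X)) + ((?Y - ?X) o\<^sub>L ?X)"
    by (rule blinfun_eqI) (simp add: blinfun.bilinear_simps del: sqrt_iter.simps)
  finally have "norm (sqrt_iter S (Suc (Suc n)) - ?Y)
      = norm ((?Y o\<^sub>L (?Y - ?X)) + ((?Y - ?X) o\<^sub>L ?X)) / 2"
    by (simp del: sqrt_iter.simps)
  also have "norm ((?Y o\<^sub>L (?Y - ?X)) + ((?Y - ?X) o\<^sub>L ?X)) \<le> ?y * (?y - ?x) + (?y - ?x) * ?x"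
  proof (intro norm_triangle_le add_mono)
    show "norm (?Y o\<^sub>L (?Y - ?X)) \<le> ?y * (?y - ?x)"
      by (rule order_trans[OF norm_blinfun_compose])
        (intro mult_mono norm_sqrt_iter_le[OF assms] Suc xy norm_ge_zero)
    show "norm ((?Y - ?X) o\<^sub>L ?X) \<le> (?y - ?x) * ?x"
      by (rule order_trans[OF norm_blinfun_compose])
        (intro mult_mono norm_sqrt_iter_le[OF assms] Suc norm_ge_zero,
          use \<open>?x \<le> ?y\<close> in linarith)
  qed
  also have "(?y * (?y - ?x) + (?y - ?x) * ?x) / 2 = (1 + ?y\<^sup>2) / 2 - (1 + ?x\<^sup>2) / 2"
    by (simp add: algebra_simps power2_eq_square diff_divide_distrib add_divide_distrib
        del: sqrt_iter_bound.simps)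
  finally show ?case by (simp only: sqrt_iter_bound.simps divide_right_mono)
qed

text \<open>The scalar increments telescope to a convergent sequence, so the operator increments are
  absolutely summable. The fixed-point equation is the limit of the recursion.\<close>

lemma sqrt_iter_convergent:
  fixes S :: "'a::banach \<Rightarrow>\<^sub>L 'a"
  assumes "norm S \<le> 1"
  obtains Y where "sqrt_iter S \<longlonglongrightarrow> Y" and "norm Y \<le> 1"
    and "2 *\<^sub>R Y = S + (Y o\<^sub>L Y)"
proof -
  have "convergent sqrt_iter_bound"
    using incseq_convergent[OF incseq_sqrt_iter_bound, of 1] sqrt_iter_bound_range
    by (metis convergentI)
  then have "summable (\<lambda>n. sqrt_iter_bound (Suc n) - sqrt_iter_bound n)"
    using telescope_summable convergent_LIMSEQ_iff by blast
  then have "summable (\<lambda>n. sqrt_iter S (Suc n) - sqrt_iter S n)"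
    by (rule summable_comparison_test'[where N = 0])
      (simp add: norm_sqrt_iter_Suc_diff_le[OF assms] del: sqrt_iter.simps sqrt_iter_bound.simps)
  then have "convergent (\<lambda>n. \<Sum>i<n. sqrt_iter S (Suc i) - sqrt_iter S i)"
    by (simp only: summable_iff_convergent)
  then have "convergent (sqrt_iter S)"
    by (simp add: sum_lessThan_telescope del: sqrt_iter.simps(2))
  then obtain Y where Y: "sqrt_iter S \<longlonglongrightarrow> Y" by (auto simp: convergent_def)
  have "norm Y \<le> 1"
  proof (rule LIMSEQ_le_const2[OF tendsto_norm[OF Y]])
    show "\<exists>N. \<forall>n\<ge>N. norm (sqrt_iter S n) \<le> 1"
      using norm_sqrt_iter_le[OF assms] sqrt_iter_bound_range order_trans by blast
  qed
  moreover have "(\<lambda>n. sqrt_iter S (Suc n)) \<longlonglongrightarrow> (1/2) *\<^sub>R (S + (Y o\<^sub>L Y))"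
    unfolding sqrt_iter.simps
    by (intro tendsto_intros bounded_bilinear.tendsto[OF bounded_bilinear_blinfun_compose] Y)
  then have "Y = (1/2) *\<^sub>R (S + (Y o\<^sub>L Y))"
    using LIMSEQ_Suc[OF Y] LIMSEQ_unique by blast
  then have "2 *\<^sub>R Y = S + (Y o\<^sub>L Y)"
    by (metis (no_types) scaleR_half_double scaleR_2 real_vector.scale_right_distrib)
  ultimately show ?thesis using that Y by blast
qed

text \<open>The root is \<open>I - Y\<close>. It is positive because \<open>Y\<close> is
  self-adjoint, so its quadratic form is real, and \<open>norm Y \<le> 1\<close> bounds that form by
  \<open>(norm x)\<^sup>2\<close>.\<close>

lemma positive_sqrt_exists:
  fixes S :: "'a::chilbert_space \<Rightarrow> 'a"
  assumes S: "bounded_clinear S" and contr: "\<And>x. norm (S x) \<le> norm x"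
    and selfadj: "\<And>x y. cinner (S x) y = cinner x (S y)"
  shows "\<exists>P. positive_op P \<and> (\<forall>x. P (P x) = x - S x)"
proof -
  have blS: "bounded_linear S" and Sc: "\<And>c x. S (c *\<^sub>C x) = c *\<^sub>C S x"
    using S by (auto simp: bounded_clinear_def)
  define F where "F = Blinfun S"
  have F: "blinfun_apply F = S" using blS by (simp add: F_def bounded_linear_Blinfun_apply)
  have "norm F \<le> 1" using contr by (intro norm_blinfun_bound) (auto simp: F)
  then obtain Y where Y: "sqrt_iter F \<longlonglongrightarrow> Y" and normY: "norm Y \<le> 1"
    and eq: "2 *\<^sub>R Y = F + (Y o\<^sub>L Y)"
    by (rule sqrt_iter_convergent)
  have lim: "(\<lambda>n. sqrt_iter F n x) \<longlonglongrightarrow> Y x" for x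
    using blinfun.tendsto[OF Y tendsto_const] .
  \<comment> \<open>Elements of the \<open>blinfun\<close> type are only real linear, so complex
    homogeneity is proved for the iterates and passed to the limit. The last rule gives
    \<open>c *\<^sub>C 0 = 0\<close> for the base case.\<close>
  have "sqrt_iter F n (c *\<^sub>C x) = c *\<^sub>C sqrt_iter F n x" for n c x
    by (induction n arbitrary: x)
      (simp_all add: blinfun.bilinear_simps F Sc scaleC_add_right scaleC_scaleR
        scaleC_diff_right[of _ 0 0, simplified])
  then have Yc: "Y (c *\<^sub>C x) = c *\<^sub>C Y x" for c x
  proof -
    have bl: "bounded_linear (\<lambda>x::'a. c *\<^sub>C x)"
      using bounded_clinear_scaleC by (auto simp: bounded_clinear_def)
    have "(\<lambda>n. c *\<^sub>C sqrt_iter F n x) \<longlonglongrightarrow> c *\<^sub>C Y x"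
      by (rule bounded_linear.tendsto[OF bl lim])
    with lim[of "c *\<^sub>C x"] show ?thesis
      using \<open>\<And>n c x. sqrt_iter F n (c *\<^sub>C x) = c *\<^sub>C sqrt_iter F n x\<close> LIMSEQ_unique by auto
  qed
  have adj_n: "cinner (sqrt_iter F n x) y = cinner x (sqrt_iter F n y)" for n x y
  proof (induction n arbitrary: x y)
    case 0
    have "cinner 0 y = 0" "cinner x 0 = 0"
      using bounded_bilinear.zero_left[OF bounded_bilinear_cinner]
        bounded_bilinear.zero_right[OF bounded_bilinear_cinner] by auto
    then show ?case by simp
  qed (simp add: blinfun.bilinear_simps F selfadj cinner_add_left cinner_add_right
      cinner_scaleR_left cinner_scaleR_right)
  have Yadj: "cinner (Y x) y = cinner x (Y y)" for x y
  proof (rule LIMSEQ_unique)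
    show "(\<lambda>n. cinner (sqrt_iter F n x) y) \<longlonglongrightarrow> cinner (Y x) y"
      by (intro bounded_bilinear.tendsto[OF bounded_bilinear_cinner] lim tendsto_const)
    show "(\<lambda>n. cinner (sqrt_iter F n x) y) \<longlonglongrightarrow> cinner x (Y y)"
      unfolding adj_n by (intro bounded_bilinear.tendsto[OF bounded_bilinear_cinner] lim tendsto_const)
  qed
  define P where "P x = x - Y x" for x
  have "bounded_clinear P"
    unfolding bounded_clinear_def P_def
    by (auto simp: scaleC_diff_right Yc intro!: bounded_linear_intros)
  moreover have "cinner (P x) x \<in> \<real>\<^sub>\<ge>\<^sub>0" for x
  proof -
    have "cinner (Y x) x = cnj (cinner (Y x) x)" by (metis Yadj cinner_commute)
    then have "Im (cinner (Y x) x) = 0" by (simp add: complex_eq_iff)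
    moreover have "Re (cinner (Y x) x) \<le> (norm x)\<^sup>2"
    proof -
      have "Re (cinner (Y x) x) \<le> norm (Y x) * norm x" by (rule Re_cinner_le)
      also have "norm (Y x) \<le> 1 * norm x"
        using norm_blinfun[of Y x] mult_right_mono[OF normY, of "norm x"] by simp
      finally show ?thesis by (simp add: power2_eq_square mult_right_mono)
    qed
    ultimately show ?thesis
      by (simp add: complex_nonneg_Reals_iff P_def cinner_diff_left cinner_self)
  qed
  ultimately have "positive_op P" by (simp add: positive_op_def)
  moreover have "P (P x) = x - S x" for x
  proof -
    have "2 *\<^sub>R Y x = S x + Y (Y x)"
      using arg_cong[OF eq, of "\<lambda>Z. blinfun_apply Z x"] by (simp add: blinfun.bilinear_simps F)
    then show ?thesis by (simp add: P_def blinfun.bilinear_simps scaleR_2 algebra_simps)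
  qed
  ultimately show ?thesis by blast
qed

text \<open>Rescaling reduces to the previous lemma: \<open>S = I - T*T / K\<^sup>2\<close> is a
  self-adjoint contraction, and \<open>K\<close> times a root of \<open>I - S\<close> is a root of
  \<open>T*T\<close>. This root is a witness for the choice in \<open>sqrt_op\<close>.\<close>

lemma abs_op_abs_op:
  fixes T :: "'a::chilbert_space \<Rightarrow> 'a"
  assumes T: "bounded_clinear T"
  shows "abs_op T (abs_op T x) = adjoint_op T (T x)"
proof -
  let ?T' = "adjoint_op T"
  note T' = bounded_clinear_adjoint_op[OF T]
  have TT: "bounded_clinear (\<lambda>x. ?T' (T x))" by (rule bounded_clinear_comp[OF T' T])
  then have blTT: "bounded_linear (\<lambda>x. ?T' (T x))"
    and TTc: "\<And>c x. ?T' (T (c *\<^sub>C x)) = c *\<^sub>C ?T' (T x)"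
    by (auto simp: bounded_clinear_def)
  \<comment> \<open>\<open>K\<close> bounds the adjoint, so that \<open>norm (?T' (T x))\<close> is
    at most \<open>K * norm (T x)\<close>.\<close>
  obtain K where K: "0 < K" "\<And>x. norm (?T' x) \<le> norm x * K"
    using T' bounded_linear.pos_bounded unfolding bounded_clinear_def by blast
  define S where "S x = x - (1 / K\<^sup>2) *\<^sub>R ?T' (T x)" for x
  have S: "bounded_clinear S"
    unfolding bounded_clinear_def S_def
    by (auto simp: scaleC_diff_right TTc scaleC_scaleR intro!: bounded_linear_sub
        bounded_linear_ident bounded_linear_const_scaleR blTT)
  have "norm (S x) \<le> norm x" for x
  proof -
    \<comment> \<open>In the expansion of \<open>(norm (S x))\<^sup>2\<close> the quadratic term is
      at most half the size of the negative cross term.\<close>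
    have "Re (cinner x (?T' (T x))) = (norm (T x))\<^sup>2"
      by (simp add: cinner_adjoint_op[OF T, symmetric] cinner_self)
    then have "(norm (S x))\<^sup>2
        = (norm x)\<^sup>2 - 2 * ((norm (T x))\<^sup>2 / K\<^sup>2) + (norm (?T' (T x)) / K\<^sup>2)\<^sup>2"
      by (simp add: S_def norm_diff_square cinner_scaleR_right)
    also have "(norm (?T' (T x)) / K\<^sup>2)\<^sup>2 \<le> (norm (T x) * K / K\<^sup>2)\<^sup>2"
      using K by (intro power_mono divide_right_mono) auto
    also have "(norm (T x) * K / K\<^sup>2)\<^sup>2 = (norm (T x))\<^sup>2 / K\<^sup>2"
      using K(1) by (simp add: power_divide power_mult_distrib field_simps power2_eq_square)
    finally have "(norm (S x))\<^sup>2 \<le> (norm x)\<^sup>2 - (norm (T x))\<^sup>2 / K\<^sup>2" by simp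
    also have "\<dots> \<le> (norm x)\<^sup>2" by simp
    finally have "(norm (S x))\<^sup>2 \<le> (norm x)\<^sup>2" .
    then show ?thesis by (rule power2_le_imp_le) simp
  qed
  moreover have "cinner (S x) y = cinner x (S y)" for x y
    by (simp add: S_def cinner_diff_left cinner_diff_right cinner_scaleR_left cinner_scaleR_right
        cinner_adjoint_op'[OF T] cinner_adjoint_op[OF T])
  ultimately obtain P where P: "positive_op P" and PP: "\<And>x. P (P x) = x - S x"
    using positive_sqrt_exists[OF S] by blast
  define Q where "Q x = K *\<^sub>R P x" for x
  have blP: "bounded_linear P" and Pc: "\<And>c x. P (c *\<^sub>C x) = c *\<^sub>C P x"
    and Ppos: "\<And>x. cinner (P x) x \<in> \<real>\<^sub>\<ge>\<^sub>0"
    using P by (auto simp: positive_op_def bounded_clinear_def)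
  have "positive_op Q"
    unfolding positive_op_def bounded_clinear_def Q_def
    using Ppos K(1)
    by (auto simp: Pc scaleC_scaleR cinner_scaleR_left complex_nonneg_Reals_iff
        intro!: bounded_linear_const_scaleR blP)
  moreover have "Q \<circ> Q = ?T' \<circ> T"
  proof
    fix x
    have "Q (Q x) = (K * K) *\<^sub>R P (P x)"
      by (simp add: Q_def linear_scale[OF bounded_linear.linear[OF blP]])
    also have "\<dots> = ?T' (T x)"
      using K(1) by (simp add: PP S_def power2_eq_square)
    finally show "(Q \<circ> Q) x = (?T' \<circ> T) x" by simp
  qed
  ultimately have "\<exists>P. positive_op P \<and> P \<circ> P = ?T' \<circ> T" by blast
  from someI_ex[OF this] have "abs_op T \<circ> abs_op T = ?T' \<circ> T"
    unfolding abs_op_def sqrt_op_def by blast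
  then show ?thesis by (metis comp_apply)
qed

section \<open>The Davis-Wielandt radius\<close>

text \<open>The left-hand side is the quadratic form at \<open>x\<close> of the operator inside
  \<open>onorm\<close>; Cauchy-Schwarz then bounds it.\<close>

lemma quadratic_form_le_onorm:
  fixes A B :: "'a::chilbert_space \<Rightarrow> 'a"
  assumes A: "bounded_clinear A" and B: "bounded_clinear B"
  shows "(norm (B x))\<^sup>2 + (norm (adjoint_op A x))\<^sup>2 + 2 * (norm (adjoint_op B (B x)))\<^sup>2
    \<le> onorm (\<lambda>x. (abs_op B ^^ 2) x + (abs_op (adjoint_op A) ^^ 2) x + 2 *\<^sub>R (abs_op B ^^ 4) x)
      * (norm x)\<^sup>2"
proof -
  let ?A' = "adjoint_op A" and ?B' = "adjoint_op B"
  note A' = bounded_clinear_adjoint_op[OF A] and B' = bounded_clinear_adjoint_op[OF B]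
  \<comment> \<open>Only even powers of absolute values occur, so each can be replaced by products
    of operators and adjoints, which move across the inner product.\<close>
  define M where
    "M = (\<lambda>x. ?B' (B x) + adjoint_op ?A' (?A' x) + 2 *\<^sub>R ?B' (B (?B' (B x))))"
  have M: "(\<lambda>x. (abs_op B ^^ 2) x + (abs_op ?A' ^^ 2) x + 2 *\<^sub>R (abs_op B ^^ 4) x) = M"
    by (simp add: M_def fun_eq_iff eval_nat_numeral abs_op_abs_op[OF B] abs_op_abs_op[OF A'])
  have bl: "bounded_linear A" "bounded_linear B" "bounded_linear ?A'" "bounded_linear ?B'"
    "bounded_linear (adjoint_op ?A')"
    using A B A' B' bounded_clinear_adjoint_op[OF A'] by (auto simp: bounded_clinear_def)
  have blM: "bounded_linear M"
    unfolding M_def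
    by (intro bounded_linear_add bounded_linear_const_scaleR bounded_linear_compose[OF bl(4)]
        bounded_linear_compose[OF bl(2)] bounded_linear_compose[OF bl(5)] bl)
  have "cinner x (M x) = cinner (B x) (B x) + cinner (?A' x) (?A' x)
      + 2 * cinner (?B' (B x)) (?B' (B x))"
    by (simp add: M_def cinner_add_right cinner_scaleR_right cinner_adjoint_op[OF A', symmetric]
        cinner_adjoint_op[OF B, symmetric] cinner_adjoint_op'[OF B, symmetric])
  then have "(norm (B x))\<^sup>2 + (norm (?A' x))\<^sup>2 + 2 * (norm (?B' (B x)))\<^sup>2 = Re (cinner x (M x))"
    by (simp add: cinner_self)
  also have "\<dots> \<le> norm x * norm (M x)" by (rule Re_cinner_le)
  also have "\<dots> \<le> norm x * (onorm M * norm x)"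
    by (intro mult_left_mono onorm[OF blM]) simp
  finally show ?thesis unfolding M by (simp add: power2_eq_square mult_ac)
qed

lemma dw_op_matrix_le:
  fixes A B :: "'a::chilbert_space \<Rightarrow> 'a"
  assumes A: "bounded_clinear A" and B: "bounded_clinear B" and z: "norm z = 1"
  defines "T \<equiv> op_matrix (\<lambda>x. 0) A B (\<lambda>x. 0)"
  shows "(cmod (cinner (T z) z))\<^sup>2 + norm (T z) ^ 4 \<le>
    1 / 2 * max
      (onorm (\<lambda>x. (abs_op B ^^ 2) x + (abs_op (adjoint_op A) ^^ 2) x + 2 *\<^sub>R (abs_op B ^^ 4) x))
      (onorm (\<lambda>x. (abs_op A ^^ 2) x + (abs_op (adjoint_op B) ^^ 2) x + 2 *\<^sub>R (abs_op A ^^ 4) x))"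
    (is "_ \<le> 1 / 2 * max ?M ?N")
proof -
  let ?A' = "adjoint_op A" and ?B' = "adjoint_op B"
  obtain x y where xy: "z = (x, y)" by fastforce
  have Tz: "T z = (A y, B x)" by (simp add: T_def op_matrix_def xy)
  have norm_pair: "(norm (u, v))\<^sup>2 = (norm u)\<^sup>2 + (norm v)\<^sup>2" for u v :: 'a
    by (simp add: norm_Pair)
  have "cmod (cinner (T z) z) \<le> norm (T z)" using cmod_cinner_le[of "T z" z] z by simp
  then have 1: "(cmod (cinner (T z) z))\<^sup>2 \<le> (norm (A y))\<^sup>2 + (norm (B x))\<^sup>2"
    using norm_pair Tz power_mono[of _ _ 2] by (metis norm_ge_zero)
  \<comment> \<open>The pair on the right is the adjoint of \<open>T\<close> applied to
    \<open>z\<close>, computed componentwise.\<close>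
  have "cinner (T z) z = cinner z (?B' y, ?A' x)"
    using Tz by (simp add: xy cinner_prod_def cinner_adjoint_op[OF A] cinner_adjoint_op[OF B])
  then have "cmod (cinner (T z) z) \<le> norm (?B' y, ?A' x)"
    using cmod_cinner_le[of z "(?B' y, ?A' x)"] z by simp
  then have 2: "(cmod (cinner (T z) z))\<^sup>2 \<le> (norm (?B' y))\<^sup>2 + (norm (?A' x))\<^sup>2"
    using norm_pair power_mono[of _ _ 2] by (metis norm_ge_zero)
  \<comment> \<open>The pair on the right is \<open>T*T z\<close>: the block diagonal form keeps
    \<open>x\<close> and \<open>y\<close> apart.\<close>
  have "cinner (T z) (T z) = cinner z (?B' (B x), ?A' (A y))"
    using Tz by (simp add: xy cinner_prod_def cinner_adjoint_op[OF A] cinner_adjoint_op[OF B])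
  then have "(norm (T z))\<^sup>2 \<le> norm (?B' (B x), ?A' (A y))"
    using Re_cinner_le[of z "(?B' (B x), ?A' (A y))"] z by (metis cinner_self Re_complex_of_real mult_1)
  then have "((norm (T z))\<^sup>2)\<^sup>2 \<le> (norm (?B' (B x), ?A' (A y)))\<^sup>2" by (intro power_mono) auto
  then have 3: "norm (T z) ^ 4 \<le> (norm (?B' (B x)))\<^sup>2 + (norm (?A' (A y)))\<^sup>2"
    by (simp add: norm_pair flip: power_mult)
  \<comment> \<open>The squared norms of \<open>x\<close> and \<open>y\<close> are weights with sum
    1, so the weighted mean is at most the maximum.\<close>
  have "?M * (norm x)\<^sup>2 + ?N * (norm y)\<^sup>2 \<le> max ?M ?N * (norm x)\<^sup>2 + max ?M ?N * (norm y)\<^sup>2"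
    by (intro add_mono mult_right_mono) auto
  also have "\<dots> = max ?M ?N * (norm z)\<^sup>2" by (simp only: xy norm_pair distrib_left)
  finally have "?M * (norm x)\<^sup>2 + ?N * (norm y)\<^sup>2 \<le> max ?M ?N" by (simp add: z)
  \<comment> \<open>Half of \<open>1\<close> plus half of \<open>2\<close> plus \<open>3\<close>:
    the terms in \<open>x\<close> form half the first quadratic form, those in \<open>y\<close> half
    the second.\<close>
  with 1 2 3 quadratic_form_le_onorm[OF A B, of x] quadratic_form_le_onorm[OF B A, of y]
  show ?thesis by linarith
qed

theorem theorem3p15:
  fixes A B :: "'a::chilbert_space \<Rightarrow> 'a"
  assumes "bounded_clinear A" and "bounded_clinear B"
  shows "(dw_radius (op_matrix (\<lambda>x. 0) A B (\<lambda>x. 0)))\<^sup>2 \<le>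
    1 / 2 * max
      (onorm (\<lambda>x. (abs_op B ^^ 2) x + (abs_op (adjoint_op A) ^^ 2) x + 2 *\<^sub>R (abs_op B ^^ 4) x))
      (onorm (\<lambda>x. (abs_op A ^^ 2) x + (abs_op (adjoint_op B) ^^ 2) x + 2 *\<^sub>R (abs_op A ^^ 4) x))"
    (is "(dw_radius ?T)\<^sup>2 \<le> ?R")
proof -
  let ?D = "insert 0 {sqrt ((cmod (cinner (?T z) z))\<^sup>2 + norm (?T z) ^ 4) | z. norm z = 1}"
  \<comment> \<open>The bound must also dominate the inserted element 0. A unit vector gives this at
    once; otherwise the space is trivial and both operator norms are 0.\<close>
  have "0 \<le> ?R"
  proof (cases "\<exists>z::'a \<times> 'a. norm z = 1")
    case True
    then obtain z :: "'a \<times> 'a" where "norm z = 1" by blast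
    from dw_op_matrix_le[OF assms this] show ?thesis
      by (rule order_trans[rotated]) simp
  next
    case False
    have zero: "(x::'a) = 0" for x
    proof (rule ccontr)
      assume "x \<noteq> 0"
      then have "norm ((1 / norm x) *\<^sub>R x, 0::'a) = 1" by (simp add: norm_Pair)
      with False show False by blast
    qed
    have zero_fun: "f = (\<lambda>x. 0)" for f :: "'a \<Rightarrow> 'a" by (rule ext) (rule zero)
    have "onorm f = 0" for f :: "'a \<Rightarrow> 'a" by (subst zero_fun[of f]) (rule onorm_zero)
    then show ?thesis by simp
  qed
  have le: "d \<le> sqrt ?R" if "d \<in> ?D" for d
    using that
  proof
    assume "d = 0"
    with \<open>0 \<le> ?R\<close> show ?thesis by simp
  next
    assume "d \<in> {sqrt ((cmod (cinner (?T z) z))\<^sup>2 + norm (?T z) ^ 4) | z. norm z = 1}"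
    then show ?thesis using dw_op_matrix_le[OF assms] by (auto intro!: real_sqrt_le_mono)
  qed
  have "dw_radius ?T \<le> sqrt ?R"
    unfolding dw_radius_def using le by (intro cSup_least) auto
  \<comment> \<open>The set contains 0 and is bounded above, so its supremum is nonnegative and
    squaring preserves the inequality.\<close>
  moreover have "0 \<le> dw_radius ?T"
    unfolding dw_radius_def using le by (intro cSup_upper bdd_aboveI[where M = "sqrt ?R"]) auto
  ultimately have "(dw_radius ?T)\<^sup>2 \<le> (sqrt ?R)\<^sup>2" by (rule power_mono)
  with \<open>0 \<le> ?R\<close> show ?thesis by simp
qed

end
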